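(* Let $n\geq 2$ be an integer and let $\alpha=(\alpha_{1},\dots,\alpha_{n})$ and $\beta=(\beta_{1},\dots,\beta_{n})$ be two $n$-tuples of negative real numbers such that $1,\alpha_{1},\dots,\alpha_{n},\beta_{1},\dots,\beta_{n}$ are linearly independent over $\mathbb{Q}$. Set $$A_{\alpha,\beta}=\mathbb{N}^{n}+i\mathbb{N}^{n}+\mathbb{N}[\alpha_{1}+i\beta_{1},\dots,\alpha_{n}+i\beta_{n}]^{T}\subset\mathbb{C}^{n},$$ that is, the set of all vectors $p+iq+s[\alpha_{1}+i\beta_{1},\dots,\alpha_{n}+i\beta_{n}]^{T}$ with $p,q\in\mathbb{N}^{n}$ (viewed as column vectors) and $s\in\mathbb{N}$. Then $A_{\alpha,\beta}$ is dense in $\mathbb{C}^{n}$, and for every nontrivial (complex) linear subspace $M$ of $\mathbb{C}^{n}$, the set $A_{\alpha,\beta}\cap M$ is not dense in $M$.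
   Context: $\mathbb{N}$ denotes the set of non-negative integers (including $0$). $v^{T}$ denotes the transpose of a row vector $v$. A subspace $M$ of a vector space $X$ is called nontrivial if $M\neq\{0\}$ and $M\neq X$. Density is with respect to the usual topology of $\mathbb{C}^{n}$ (and, for $M$, the induced topology). *)

theory Defs
  imports "HOL-Analysis.Analysis"
begin

text \<open>
  Linear independence over the rationals of a family of reals, the reals being viewed as a rational
  vector space. The library notion speaks about sets of vectors, so injectivity of the
  family is required in addition.
\<close>

definition rat_independent_family :: "('i \<Rightarrow> real) \<Rightarrow> bool" where
  "rat_independent_family x \<longleftrightarrow>
     inj x \<and> \<not> module.dependent (\<lambda>(c :: rat) (r :: real). of_rat c * r) (range x)"

lemma vector_space_rat_real: "vector_space (\<lambda>(c :: rat) (r :: real). of_rat c * r)"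
  by unfold_locales (simp_all add: ring_distribs of_rat_add of_rat_mult)

lemmas rat_dependent_finite =
  module.dependent_finite[OF vector_space_rat_real[folded module_iff_vector_space]]

lemma rat_independent_family_iff:
  fixes x :: "'i :: finite \<Rightarrow> real"
  shows "rat_independent_family x \<longleftrightarrow>
    (\<forall>c :: 'i \<Rightarrow> rat. (\<Sum>i\<in>UNIV. of_rat (c i) * x i) = 0 \<longrightarrow> (\<forall>i. c i = 0))"
proof
  assume L: "rat_independent_family x"
  then have inj: "inj x" and ind: "\<not> module.dependent (\<lambda>(c :: rat) (r :: real). of_rat c * r) (range x)"
    by (simp_all add: rat_independent_family_def)
  show "\<forall>c :: 'i \<Rightarrow> rat. (\<Sum>i\<in>UNIV. of_rat (c i) * x i) = 0 \<longrightarrow> (\<forall>i. c i = 0)"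
  proof (intro allI impI)
    fix c :: "'i \<Rightarrow> rat" and i
    assume "(\<Sum>i\<in>UNIV. of_rat (c i) * x i) = 0"
    then have "(\<Sum>v\<in>range x. of_rat (c (inv x v)) * v) = 0"
      unfolding sum.reindex[OF inj] o_def inv_f_f[OF inj] .
    moreover have "(\<exists>v\<in>range x. c (inv x v) \<noteq> 0) \<longrightarrow> (\<Sum>v\<in>range x. of_rat (c (inv x v)) * v) \<noteq> 0"
      using ind[unfolded rat_dependent_finite[OF finite_imageI[OF finite]], unfolded not_ex,
          THEN spec, of "\<lambda>v. c (inv x v)"] by argo
    ultimately have "c (inv x (x i)) = 0"
      by (meson rangeI)
    then show "c i = 0"
      unfolding inv_f_f[OF inj] .
  qed
next
  assume R: "\<forall>c :: 'i \<Rightarrow> rat. (\<Sum>i\<in>UNIV. of_rat (c i) * x i) = 0 \<longrightarrow> (\<forall>i. c i = 0)"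
  have inj: "inj x"
  proof (rule injI, rule ccontr)
    fix i j assume eq: "x i = x j" and ne: "i \<noteq> j"
    have "(\<Sum>k\<in>UNIV. of_rat (if k = i then 1 else if k = j then - 1 else 0) * x k)
        = (\<Sum>k\<in>UNIV. (if k = i then x k else 0) - (if k = j then x k else 0))"
      by (rule sum.cong[OF refl]) (use ne in simp)
    also have "\<dots> = 0"
      using eq by (simp add: sum_subtractf)
    finally show False
      using R[rule_format, of "\<lambda>k. if k = i then 1 else if k = j then - 1 else 0" i] by simp
  qed
  have "\<not> module.dependent (\<lambda>(c :: rat) (r :: real). of_rat c * r) (range x)"
  proof
    assume "module.dependent (\<lambda>(c :: rat) (r :: real). of_rat c * r) (range x)"
    then obtain u v where u: "v \<in> range x" "u v \<noteq> 0" "(\<Sum>v\<in>range x. of_rat (u v) * v) = 0"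
      unfolding rat_dependent_finite[OF finite_imageI[OF finite]] by blast
    then have "(\<Sum>i\<in>UNIV. of_rat (u (x i)) * x i) = 0"
      unfolding sum.reindex[OF inj] o_def by blast
    then show False
      using R[rule_format, of "\<lambda>i. u (x i)"] u(1,2) by blast
  qed
  then show "rat_independent_family x"
    using inj by (simp add: rat_independent_family_def)
qed

definition A_set :: "real ^ 'n \<Rightarrow> real ^ 'n \<Rightarrow> (complex ^ 'n) set" where
  "A_set \<alpha> \<beta> =
     {(\<chi> j. of_nat (p $ j) + \<i> * of_nat (q $ j) + of_nat s * Complex (\<alpha> $ j) (\<beta> $ j)) |
        (p :: nat ^ 'n) (q :: nat ^ 'n) (s :: nat). True}"

end

theory Submission
  imports Defs
begin

text \<open>
  Write \<open>w = \<alpha> + i \<beta>\<close>. Density is simultaneous Kronecker approximation for the multiples \<open>s w\<close>: once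
  \<open>s\<close> is large, all coordinates of \<open>s w\<close> are very negative, so the integers correcting them are
  automatically non-negative.

  Let \<open>M\<close> be a nontrivial subspace and \<open>S\<close> the set of Gaussian integer vectors in \<open>M\<close>. If no element
  \<open>g + s w\<close> of \<open>M\<close> has \<open>s > 0\<close>, then \<open>A \<inter> M\<close> is discrete. Otherwise pick \<open>v\<^sub>0 = g\<^sub>0 + s\<^sub>0 w\<close> in \<open>M\<close> with
  \<open>s\<^sub>0 > 0\<close>; for every \<open>v = g + s w\<close> in \<open>A \<inter> M\<close> the vector \<open>s\<^sub>0 v - s v\<^sub>0\<close> lies in \<open>S\<close>. If \<open>v\<^sub>0\<close> is not in
  the span of \<open>S\<close>, a linear form vanishing on \<open>S\<close> with value \<open>1\<close> at \<open>v\<^sub>0\<close> takes only the values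
  \<open>s / s\<^sub>0 \<ge> 0\<close> on \<open>A \<inter> M\<close>, so \<open>- v\<^sub>0\<close> cannot be approximated. If \<open>v\<^sub>0\<close> is in the span of \<open>S\<close>, apply a
  rational linear map from the reals to the rationals to the coefficients of a linear form vanishing
  on \<open>M\<close>: this yields a nonzero form with coefficients in \<open>\<rat>(i)\<close> that still vanishes on \<open>S\<close>, hence at
  \<open>v\<^sub>0\<close>, and its real part is a rational relation between \<open>1\<close>, the \<open>\<alpha>\<^sub>j\<close> and the \<open>\<beta>\<^sub>j\<close>.
\<close>

section \<open>Linear functionals separating a vector from a subspace\<close>

text \<open>A basis of \<open>N\<close> enlarged by \<open>v\<close> stays independent and extends
  to a basis \<open>B\<close>; the functional is the \<open>v\<close>-coordinate in
  \<open>B\<close>. The scalar field is arbitrary, so this serves both complex vectors and the reals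
  over the rationals.\<close>

lemma (in vector_space) separating_functional:
  assumes "subspace N" "v \<notin> N"
  obtains f where "\<And>x y. f (x + y) = f x + f y" "\<And>c x. f (scale c x) = c * f x"
    "\<And>x. x \<in> N \<Longrightarrow> f x = 0" "f v = 1"
proof -
  obtain BN where BN: "BN \<subseteq> N" "independent BN" "N \<subseteq> span BN"
    using basis_exists by metis
  have spanN: "span BN = N"
    using BN assms(1) span_minimal by blast
  have ind: "independent (insert v BN)"
    using BN assms(2) spanN independent_insertI by metis
  define B where "B = extend_basis (insert v BN)"
  have B: "independent B" "span B = UNIV" "insert v BN \<subseteq> B"
    unfolding B_def using extend_basis_superset[OF ind] independent_extend_basis[OF ind]
      span_extend_basis[OF ind] by auto
  have vB: "v \<in> B" using B by auto
  show thesis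
  proof
    show "representation B (x + y) v = representation B x v + representation B y v" for x y
      using B by (simp add: representation_add)
    show "representation B (scale c x) v = c * representation B x v" for c x
      using B by (simp add: representation_scale)
    show "representation B x v = 0" if "x \<in> N" for x
    proof -
      have "representation B x = representation BN x"
        using B that spanN by (intro representation_extend) auto
      moreover have "v \<notin> BN" using BN(1) assms(2) by auto
      ultimately show ?thesis using representation_ne_zero by metis
    qed
    show "representation B v v = 1"
      using B vB by (simp add: representation_basis)
  qed
qed

lemma linear_form_coordinates:
  fixes f :: "'a::field ^ 'n \<Rightarrow> 'a"
  assumes add: "\<And>x y. f (x + y) = f x + f y" and scale: "\<And>c x. f (c *s x) = c * f x"
  shows "f z = (\<Sum>j\<in>UNIV. f (axis j 1) * z $ j)"
proof -
  have zero: "f 0 = 0"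
    using scale[of 0 0] by simp
  have "f z = f (\<Sum>j\<in>UNIV. z $ j *s axis j 1)"
    by (simp add: basis_expansion)
  also have "\<dots> = (\<Sum>j\<in>UNIV. f (z $ j *s axis j 1))"
    by (rule sum_comp_morphism[unfolded o_def, symmetric]) (use zero add in auto)
  finally show ?thesis
    by (simp add: scale mult.commute)
qed

lemma separating_form:
  fixes N :: "('a::field ^ 'n) set"
  assumes "vec.subspace N" "v \<notin> N"
  obtains c where "\<And>z. z \<in> N \<Longrightarrow> (\<Sum>j\<in>UNIV. c j * z $ j) = 0" "(\<Sum>j\<in>UNIV. c j * v $ j) = 1"
proof -
  obtain f where f: "\<And>x y. f (x + y) = f x + f y" "\<And>c x. f (c *s x) = c * f x"
    "\<And>x. x \<in> N \<Longrightarrow> f x = 0" "f v = 1"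
    using vec.separating_functional[OF assms] by blast
  show thesis
    using that[of "\<lambda>j. f (axis j 1)"] linear_form_coordinates[of f, OF f(1,2)] f(3,4) by metis
qed

text \<open>Separates \<open>r\<close> from the zero subspace of the reals over the rationals. Such
  a \<open>\<phi>\<close> makes real coefficients rational and preserves their integer
  relations.\<close>

lemma rat_linear_functional:
  fixes r :: real
  assumes "r \<noteq> 0"
  obtains \<phi> :: "real \<Rightarrow> rat" where "\<And>x y. \<phi> (x + y) = \<phi> x + \<phi> y"
    "\<And>c x. \<phi> (of_rat c * x) = c * \<phi> x" "\<phi> r = 1"
proof -
  interpret Q: vector_space "\<lambda>(c :: rat) (x :: real). of_rat c * x"
    by (rule vector_space_rat_real)
  show thesis
    using Q.separating_functional[OF Q.subspace_single_0, of r] that assms by (metis singletonD)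
qed

section \<open>Simultaneous approximation and density\<close>

lemma Kronecker_approx_large:
  fixes x a :: "'i::finite \<Rightarrow> real"
  assumes ind: "rat_independent_family (case_option 1 x)" and "\<epsilon> > 0"
  obtains k :: nat and m :: "'i \<Rightarrow> int"
  where "k \<ge> K" "\<And>i. \<bar>real k * x i - m i - a i\<bar> < \<epsilon>"
proof -
  define n where "n = CARD('i)"
  obtain h where h: "bij_betw h {..<n} (UNIV :: 'i set)"
    using ex_bij_betw_nat_finite[OF finite[of UNIV]] unfolding n_def atLeast0LessThan by blast
  \<comment> \<open>Kronecker's theorem is applied to a family indexed by \<open>{..n}\<close> whose
    last entry is 1: position \<open>n\<close> goes to \<open>None\<close>, the others enumerate
    \<open>'i\<close>.\<close>
  define g where "g = (\<lambda>i. if i < n then Some (h i) else None)"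
  define \<theta> where "\<theta> = (\<lambda>i. case_option 1 x (g i))"
  have inj_x: "inj (case_option 1 x)"
    using ind by (simp add: rat_independent_family_def)
  have inj_g: "inj_on g {..n}"
    using h by (auto simp: inj_on_def g_def bij_betw_def)
  have inj: "inj_on \<theta> {..n}"
    using inj_g inj_x by (simp add: inj_on_def \<theta>_def)
  have \<theta>: "\<theta> n = 1" "\<And>i. i < n \<Longrightarrow> \<theta> i = x (h i)"
    by (auto simp: \<theta>_def g_def)
  interpret Z: Modules.module "\<lambda>r x. real_of_int r * x"
    by (simp add: Modules.module.intro distrib_left mult.commute)
  interpret Q: Modules.module "\<lambda>(c :: rat) (x :: real). of_rat c * x"
    using vector_space_rat_real module_iff_vector_space by blast
  have Qind: "Q.independent (\<theta> ` {..n})"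
    by (rule Q.independent_mono[of "range (case_option 1 x)"])
       (use ind in \<open>auto simp: rat_independent_family_def \<theta>_def\<close>)
  \<comment> \<open>An integer relation is in particular a rational one.\<close>
  have indZ: "Z.independent (\<theta> ` {..n})"
  proof
    assume "Z.dependent (\<theta> ` {..n})"
    then obtain u v where uv: "v \<in> \<theta> ` {..n}" "u v \<noteq> 0" "(\<Sum>v\<in>\<theta> ` {..n}. of_int (u v) * v) = 0"
      unfolding Z.dependent_finite[OF finite_imageI[OF finite_atMost]] by blast
    then have "(\<Sum>v\<in>\<theta> ` {..n}. of_rat (of_int (u v)) * v) = 0" "of_int (u v) \<noteq> (0 :: rat)"
      by simp_all
    then show False
      using Qind[unfolded Q.dependent_finite[OF finite_imageI[OF finite_atMost]],
          unfolded not_ex, THEN spec, of "\<lambda>v. of_int (u v)"] uv(1) by (meson bexI)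
  qed
  obtain k m where km: "\<And>i. i < n \<Longrightarrow> \<bar>of_int k * \<theta> i - of_int (m i) - a (h i)\<bar> < \<epsilon>/2"
    using Kronecker_thm_2[OF indZ inj \<theta>(1), of "\<epsilon>/2" "\<lambda>i. a (h i)"] assms(2) by auto
  \<comment> \<open>The library theorem does not control the sign of the multiplier \<open>k\<close>, so \<open>k\<close> is shifted by a large
    multiple of a Dirichlet denominator \<open>q\<close>, chosen so fine that the error stays below \<open>\<epsilon>\<close>.\<close>
  define L where "L = nat \<bar>k\<bar> + K + 1"
  obtain N :: nat where N: "N > 2 * real L / \<epsilon>"
    using reals_Archimedean2 by blast
  have "N > 0"
    using N assms(2) by (cases N) (auto simp: field_simps)
  then obtain q p where qp: "0 < q" "\<And>i. i < n \<Longrightarrow> \<bar>of_int q * \<theta> i - of_int (p i)\<bar> < 1/N"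
    using Dirichlet_approx_simult[of N n \<theta>] by metis
  have "k + int L * q \<ge> k + int L * 1"
    using qp(1) by (intro add_left_mono mult_left_mono) auto
  moreover have "k + int L \<ge> int K"
    unfolding L_def by linarith
  ultimately have ge: "k + int L * q \<ge> int K"
    by linarith
  have bound: "\<bar>of_int (k + int L * q) * \<theta> i - of_int (m i + int L * p i) - a (h i)\<bar> < \<epsilon>" if "i < n" for i
  proof -
    have "real L * \<bar>of_int q * \<theta> i - of_int (p i)\<bar> \<le> real L * (1/N)"
      using qp(2)[OF that] by (intro mult_left_mono) auto
    also have "\<dots> < \<epsilon>/2"
      using N \<open>N > 0\<close> assms(2) by (simp add: field_simps)
    finally have "\<bar>real L * (of_int q * \<theta> i - of_int (p i))\<bar> < \<epsilon>/2"
      by (simp add: abs_mult)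
    moreover have "of_int (k + int L * q) * \<theta> i - of_int (m i + int L * p i) - a (h i)
      = (of_int k * \<theta> i - of_int (m i) - a (h i)) + real L * (of_int q * \<theta> i - of_int (p i))"
      by (simp add: algebra_simps)
    ultimately show ?thesis
      using km[OF that] by linarith
  qed
  define j where "j = inv_into {..<n} h"
  have j: "j i < n" "h (j i) = i" for i
    using h inv_into_into[of i h "{..<n}"] f_inv_into_f[of i h "{..<n}"]
    by (auto simp: j_def bij_betw_def)
  show thesis
  proof
    show "nat (k + int L * q) \<ge> K"
      using ge by linarith
    show "\<bar>real (nat (k + int L * q)) * x i - of_int (m (j i) + int L * p (j i)) - a i\<bar> < \<epsilon>" for i
      using bound[OF j(1)[of i]] \<theta>(2)[OF j(1)[of i]] j(2)[of i] ge by simp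
  qed
qed

lemma closure_A_set:
  fixes \<alpha> \<beta> :: "real ^ 'n"
  assumes neg: "\<And>j. \<alpha> $ j < 0" "\<And>j. \<beta> $ j < 0"
    and ind: "rat_independent_family
           (case_option 1 (case_sum (\<lambda>j. \<alpha> $ j) (\<lambda>j. \<beta> $ j)) :: ('n + 'n) option \<Rightarrow> real)"
  shows "closure (A_set \<alpha> \<beta>) = UNIV"
proof -
  have "z \<in> closure (A_set \<alpha> \<beta>)" for z :: "complex ^ 'n"
    unfolding closure_approachable
  proof (intro allI impI)
    fix e :: real assume "e > 0"
    \<comment> \<open>Real and imaginary errors below \<open>\<epsilon>\<close> give
      \<open>2 * \<epsilon>\<close> per coordinate, and \<open>CARD('n)\<close> coordinates add up
      to \<open>e\<close>.\<close>
    define \<epsilon> where "\<epsilon> = e / (2 * CARD('n))"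
    have "\<epsilon> > 0" using \<open>e > 0\<close> by (simp add: \<epsilon>_def)
    define x where "x = case_sum (\<lambda>j. \<alpha> $ j) (\<lambda>j. \<beta> $ j)"
    define a where "a = case_sum (\<lambda>j. Re (z $ j)) (\<lambda>j. Im (z $ j))"
    have xneg: "x i < 0" for i
      using neg by (auto simp: x_def split: sum.split)
    \<comment> \<open>From \<open>K\<close> on the integers approximating \<open>s x - a\<close> are non-positive.\<close>
    have "\<exists>K::nat. \<forall>i. real K * (- x i) \<ge> \<epsilon> + \<bar>a i\<bar>"
    proof -
      have "\<forall>i. \<exists>K::nat. \<epsilon> + \<bar>a i\<bar> < real K * (- x i)"
        using xneg reals_Archimedean3 by (metis neg_0_less_iff_less)
      then obtain K where K: "\<And>i. \<epsilon> + \<bar>a i\<bar> < real (K i) * (- x i)" by metis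
      have "real (K i) * (- x i) \<le> real (\<Sum>i\<in>UNIV. K i) * (- x i)" for i
        using xneg[of i] member_le_sum[of i UNIV K] by (intro mult_right_mono) (simp_all del: of_nat_sum)
      then show ?thesis
        using K by (meson less_le_trans less_imp_le)
    qed
    then obtain K :: nat where K: "\<And>i. real K * (- x i) \<ge> \<epsilon> + \<bar>a i\<bar>" by blast
    obtain s m where s: "s \<ge> K" and m: "\<And>i. \<bar>real s * x i - of_int (m i) - a i\<bar> < \<epsilon>"
      using Kronecker_approx_large[OF ind[folded x_def] \<open>\<epsilon> > 0\<close>] by metis
    have mneg: "m i \<le> 0" for i
    proof -
      have "real K * (- x i) \<le> real s * (- x i)"
        using s xneg[of i] by (intro mult_right_mono) auto
      then have "of_int (m i) \<le> (0 :: real)"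
        using K[of i] m[of i] by linarith
      then show ?thesis by simp
    qed
    have real_nat: "real (nat (- m i)) = - of_int (m i)" for i
      using mneg[of i] by simp
    \<comment> \<open>The inner \<open>\<chi>\<close> vectors are the witnesses for \<open>p\<close>
      and \<open>q\<close> in \<open>A_set\<close>.\<close>
    define y :: "complex ^ 'n" where "y = (\<chi> j. of_nat ((\<chi> j. nat (- m (Inl j))) $ j)
       + \<i> * of_nat ((\<chi> j. nat (- m (Inr j))) $ j) + of_nat s * Complex (\<alpha> $ j) (\<beta> $ j))"
    have "y \<in> A_set \<alpha> \<beta>"
      unfolding A_set_def y_def by blast
    moreover have "dist y z < e"
    proof -
      have "norm ((y - z) $ j) < 2 * \<epsilon>" for j
      proof -
        have "\<bar>Re ((y - z) $ j)\<bar> < \<epsilon>" "\<bar>Im ((y - z) $ j)\<bar> < \<epsilon>"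
          using m[of "Inl j"] m[of "Inr j"] by (simp_all add: y_def x_def a_def real_nat algebra_simps del: of_nat_nat)
        then show ?thesis
          using cmod_le[of "(y - z) $ j"] by linarith
      qed
      then have "(\<Sum>j\<in>UNIV. norm ((y - z) $ j)) < (\<Sum>j\<in>(UNIV :: 'n set). 2 * \<epsilon>)"
        by (intro sum_strict_mono) auto
      also have "\<dots> = e"
        by (simp add: \<epsilon>_def)
      finally show ?thesis
        using L2_set_le_sum[of UNIV "\<lambda>j. norm ((y - z) $ j)"]
        by (simp add: dist_norm norm_vec_def)
    qed
    ultimately show "\<exists>y\<in>A_set \<alpha> \<beta>. dist y z < e" by blast
  qed
  then show ?thesis by blast
qed

section \<open>Gaussian integer vectors and rational forms\<close>

definition gaussian_vec :: "(complex ^ 'n) set" where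
  "gaussian_vec = {z. \<forall>j. Re (z $ j) \<in> \<int> \<and> Im (z $ j) \<in> \<int>}"

lemma A_set_cases:
  assumes "v \<in> A_set \<alpha> \<beta>"
  obtains g and s :: nat where "g \<in> gaussian_vec"
    "v = g + of_nat s *s (\<chi> j. Complex (\<alpha> $ j) (\<beta> $ j))"
proof -
  obtain p q s where v: "v = (\<chi> j. of_nat (p $ j) + \<i> * of_nat (q $ j) + of_nat s * Complex (\<alpha> $ j) (\<beta> $ j))"
    using assms unfolding A_set_def by blast
  show thesis
  proof
    show "(\<chi> j. of_nat (p $ j) + \<i> * of_nat (q $ j)) \<in> (gaussian_vec :: (complex ^ 'a) set)"
      by (simp add: gaussian_vec_def)
    show "v = (\<chi> j. of_nat (p $ j) + \<i> * of_nat (q $ j)) + of_nat s *s (\<chi> j. Complex (\<alpha> $ j) (\<beta> $ j))"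
      by (simp add: v vec_eq_iff)
  qed
qed

lemma gaussian_vec_combination:
  fixes g h :: "complex ^ 'n"
  assumes "g \<in> gaussian_vec" "h \<in> gaussian_vec"
  shows "of_nat s *s g - of_nat t *s h \<in> gaussian_vec"
  using assms by (auto simp: gaussian_vec_def)

text \<open>A rational-linear \<open>\<phi>\<close> commutes with multiplication by integers, so
  applying it to the real and imaginary parts of \<open>c\<close> keeps every relation with a
  Gaussian integer vector. The kernel of the new form is a complex subspace, hence contains the
  span.\<close>

lemma rational_annihilator:
  fixes S :: "(complex ^ 'n) set"
  assumes S: "S \<subseteq> gaussian_vec" and c: "c \<noteq> (\<lambda>_. 0)"
    and ann: "\<And>z. z \<in> S \<Longrightarrow> (\<Sum>j\<in>UNIV. c j * z $ j) = 0"
  obtains a b :: "'n \<Rightarrow> rat" where "\<exists>j. a j \<noteq> 0 \<or> b j \<noteq> 0"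
    "\<And>z. z \<in> vec.span S \<Longrightarrow> (\<Sum>j\<in>UNIV. Complex (of_rat (a j)) (of_rat (b j)) * z $ j) = 0"
proof -
  obtain j0 where "c j0 \<noteq> 0" using c by auto
  \<comment> \<open>Normalising \<open>\<phi>\<close> at a nonzero part of some coefficient keeps
    the new form nonzero.\<close>
  then obtain r where r: "r \<noteq> 0" "r = Re (c j0) \<or> r = Im (c j0)"
    by (metis complex_eq_iff zero_complex.sel)
  obtain \<phi> :: "real \<Rightarrow> rat" where add: "\<And>x y. \<phi> (x + y) = \<phi> x + \<phi> y"
    and scale: "\<And>c x. \<phi> (of_rat c * x) = c * \<phi> x" and "\<phi> r = 1"
    using rat_linear_functional[OF r(1)] by metis
  have zero: "\<phi> 0 = 0" using scale[of 0 0] by simp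
  have sum: "\<phi> (\<Sum>j\<in>A. f j) = (\<Sum>j\<in>A. \<phi> (f j))" if "finite A" for A :: "'n set" and f
    using that by (induction) (simp_all add: zero add)
  have scale_int: "of_rat (\<phi> (x * t)) = of_rat (\<phi> x) * t" if t: "t \<in> \<int>" for x t :: real
  proof -
    obtain i where t: "t = of_int i" using t by (auto elim: Ints_cases)
    have "\<phi> (of_rat (of_int i) * x) = of_int i * \<phi> x" by (rule scale)
    then show ?thesis by (simp add: t of_rat_mult mult.commute)
  qed
  have diff: "\<phi> (x - y) = \<phi> x - \<phi> y" for x y
    using add[of "x - y" y] by simp
  let ?a = "\<lambda>j. \<phi> (Re (c j))" and ?b = "\<lambda>j. \<phi> (Im (c j))"
  show thesis
  proof
    show "\<exists>j. ?a j \<noteq> 0 \<or> ?b j \<noteq> 0"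
      using r(2) \<open>\<phi> r = 1\<close> by (intro exI[of _ j0]) auto
    fix z assume "z \<in> vec.span S"
    moreover have "vec.subspace {z. (\<Sum>j\<in>UNIV. Complex (of_rat (?a j)) (of_rat (?b j)) * z $ j) = 0}"
      by (rule vec.subspaceI)
         (simp_all add: ring_distribs sum.distrib mult.left_commute sum_distrib_left[symmetric])
    moreover have "S \<subseteq> {z. (\<Sum>j\<in>UNIV. Complex (of_rat (?a j)) (of_rat (?b j)) * z $ j) = 0}"
    proof
      fix g assume g: "g \<in> S"
      then have int: "Re (g $ j) \<in> \<int>" "Im (g $ j) \<in> \<int>" for j
        using S by (auto simp: gaussian_vec_def)
      have "(\<Sum>j\<in>UNIV. Re (c j) * Re (g $ j) - Im (c j) * Im (g $ j)) = 0"
        "(\<Sum>j\<in>UNIV. Re (c j) * Im (g $ j) + Im (c j) * Re (g $ j)) = 0"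
        using ann[OF g] by (simp_all add: complex_eq_iff)
      then have "(of_rat (\<phi> (\<Sum>j\<in>UNIV. Re (c j) * Re (g $ j) - Im (c j) * Im (g $ j))) :: real) = 0"
        "(of_rat (\<phi> (\<Sum>j\<in>UNIV. Re (c j) * Im (g $ j) + Im (c j) * Re (g $ j))) :: real) = 0"
        by (simp_all only: zero of_rat_0)
      then show "g \<in> {z. (\<Sum>j\<in>UNIV. Complex (of_rat (?a j)) (of_rat (?b j)) * z $ j) = 0}"
        by (simp add: complex_eq_iff sum add diff of_rat_sum of_rat_add of_rat_diff scale_int int)
    qed
    ultimately show "(\<Sum>j\<in>UNIV. Complex (of_rat (?a j)) (of_rat (?b j)) * z $ j) = 0"
      using vec.span_minimal by blast
  qed
qed

lemma rat_sum_Ints: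
  fixes a :: "'n::finite \<Rightarrow> rat"
  assumes "\<And>j. x j \<in> \<int>"
  obtains q :: rat where "(\<Sum>j\<in>UNIV. of_rat (a j) * x j) = (of_rat q :: real)"
proof -
  have "(\<Sum>j\<in>UNIV. of_rat (a j) * x j) \<in> \<rat>"
    using assms Ints_subset_Rats by (intro Rats_sum Rats_mult) auto
  then show thesis using that by (auto elim: Rats_cases)
qed

text \<open>The real part of the form is a rational number plus \<open>s\<close> times the sum of
  \<open>a j * \<alpha> $ j - b j * \<beta> $ j\<close>; were it zero, independence and
  \<open>s > 0\<close> would force all coefficients to vanish.\<close>

lemma rational_form_nonzero:
  fixes \<alpha> \<beta> :: "real ^ 'n" and a b :: "'n \<Rightarrow> rat"
  assumes ind: "rat_independent_family
           (case_option 1 (case_sum (\<lambda>j. \<alpha> $ j) (\<lambda>j. \<beta> $ j)) :: ('n + 'n) option \<Rightarrow> real)"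
    and ab: "\<exists>j. a j \<noteq> 0 \<or> b j \<noteq> 0" and g: "g \<in> gaussian_vec" and s: "s > 0"
  shows "(\<Sum>j\<in>UNIV. Complex (of_rat (a j)) (of_rat (b j))
            * (g + of_nat s *s (\<chi> j. Complex (\<alpha> $ j) (\<beta> $ j))) $ j) \<noteq> 0"
proof
  assume "(\<Sum>j\<in>UNIV. Complex (of_rat (a j)) (of_rat (b j))
            * (g + of_nat s *s (\<chi> j. Complex (\<alpha> $ j) (\<beta> $ j))) $ j) = 0"
  then have "(\<Sum>j\<in>UNIV. of_rat (a j) * (Re (g $ j) + s * \<alpha> $ j) - of_rat (b j) * (Im (g $ j) + s * \<beta> $ j)) = (0::real)"
    by (simp add: complex_eq_iff)
  moreover obtain p q where "(\<Sum>j\<in>UNIV. of_rat (a j) * Re (g $ j)) = (of_rat p :: real)"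
    "(\<Sum>j\<in>UNIV. of_rat (b j) * Im (g $ j)) = (of_rat q :: real)"
    using rat_sum_Ints[of "\<lambda>j. Re (g $ j)" a] rat_sum_Ints[of "\<lambda>j. Im (g $ j)" b] g
    by (metis (mono_tags, lifting) gaussian_vec_def mem_Collect_eq)
  ultimately have eq: "of_rat (p - q) + (\<Sum>j\<in>UNIV. of_rat (of_nat s * a j) * \<alpha> $ j)
      + (\<Sum>j\<in>UNIV. of_rat (- of_nat s * b j) * \<beta> $ j) = 0"
    by (simp add: ring_distribs sum.distrib sum_subtractf of_rat_mult of_rat_diff of_rat_minus
        sum_negf mult_ac sum_distrib_left)
  define d :: "('n + 'n) option \<Rightarrow> rat" where
    "d = case_option (p - q) (case_sum (\<lambda>j. of_nat s * a j) (\<lambda>j. - of_nat s * b j))"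
  have "(\<Sum>i\<in>UNIV. of_rat (d i) * case_option 1 (case_sum (\<lambda>j. \<alpha> $ j) (\<lambda>j. \<beta> $ j)) i) = 0"
    using eq by (simp add: UNIV_option_conv sum.reindex UNIV_Plus_UNIV[symmetric] sum.Plus d_def
        del: UNIV_Plus_UNIV)
  then have "d i = 0" for i
    using ind unfolding rat_independent_family_iff by blast
  from this[of "Some (Inl _)"] this[of "Some (Inr _)"] have "a j = 0" "b j = 0" for j
    using s by (auto simp: d_def)
  then show False using ab by blast
qed

section \<open>Failure of density in nontrivial subspaces\<close>

lemma closure_approx_image:
  fixes f :: "'a::metric_space \<Rightarrow> 'b::metric_space"
  assumes "M \<subseteq> closure X" "m \<in> M" "e > 0"
    "continuous_on UNIV f"
  obtains y where "y \<in> X" "dist (f y) (f m) < e"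
proof -
  have "isCont f m" using assms(4) by (simp add: continuous_on_eq_continuous_at)
  then obtain d where "d > 0" "\<And>y. dist y m < d \<Longrightarrow> dist (f y) (f m) < e"
    using assms(3) unfolding continuous_at_eps_delta by blast
  moreover have "\<exists>y\<in>X. dist y m < d" if "d > 0" for d
    using assms that unfolding closure_approachable by (meson closure_approachable subsetD)
  ultimately show thesis using that by blast
qed

lemma A_set_not_dense_in_subspace:
  fixes \<alpha> \<beta> :: "real ^ 'n" and M :: "(complex ^ 'n) set"
  assumes ind: "rat_independent_family
           (case_option 1 (case_sum (\<lambda>j. \<alpha> $ j) (\<lambda>j. \<beta> $ j)) :: ('n + 'n) option \<Rightarrow> real)"
    and M: "vec.subspace M" "M \<noteq> {0}" "M \<noteq> UNIV"
  shows "\<not> M \<subseteq> closure (A_set \<alpha> \<beta> \<inter> M)"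
proof
  assume dense: "M \<subseteq> closure (A_set \<alpha> \<beta> \<inter> M)"
  define w :: "complex ^ 'n" where "w = (\<chi> j. Complex (\<alpha> $ j) (\<beta> $ j))"
  have "\<exists>g\<in>gaussian_vec. \<exists>s::nat. s > 0 \<and> g + of_nat s *s w \<in> M"
  proof (rule ccontr)
    assume contr: "\<not> ?thesis"
    have gauss: "v \<in> gaussian_vec" if v: "v \<in> A_set \<alpha> \<beta> \<inter> M" for v
    proof -
      obtain g and s :: nat where g: "g \<in> gaussian_vec" "v = g + of_nat s *s w"
        using A_set_cases[of v \<alpha> \<beta>] v unfolding w_def by blast
      then have "g + of_nat s *s w \<in> M" using v by simp
      then have "s = 0" using contr g(1) by auto
      then show ?thesis using g by simp
    qed
    obtain m where "m \<in> M" "m \<noteq> 0"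
      using M vec.subspace_0 by blast
    then obtain j where j: "m $ j \<noteq> 0" by (auto simp: vec_eq_iff)
    \<comment> \<open>The scaling makes the \<open>j\<close>-th coordinate 1/2, at distance at least
      1/2 from every integer.\<close>
    have "(1 / (2 * m $ j)) *s m \<in> M"
      using M(1) \<open>m \<in> M\<close> vec.subspace_scale by blast
    moreover have "continuous_on UNIV (\<lambda>y :: complex ^ 'n. Re (y $ j))"
      by (intro continuous_intros)
    ultimately obtain y where y: "y \<in> A_set \<alpha> \<beta> \<inter> M"
      "dist (Re (y $ j)) (Re (((1 / (2 * m $ j)) *s m) $ j)) < 1/2"
      using closure_approx_image[OF dense, of _ "1/2" "\<lambda>y. Re (y $ j)"] half_gt_zero[OF zero_less_one]
      by blast
    have "Re (y $ j) \<in> \<int>"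
      using gauss[OF y(1)] by (simp add: gaussian_vec_def)
    then obtain i where "Re (y $ j) = of_int i" by (auto elim: Ints_cases)
    with y(2) j have "\<bar>real_of_int i - 1/2\<bar> < 1/2"
      by (simp add: dist_real_def)
    then have "0 < real_of_int i" "real_of_int i < 1" by linarith+
    then show False by simp
  qed
  then obtain g0 and s0 :: nat where g0: "g0 \<in> gaussian_vec" and s0: "s0 > 0"
    and v0M: "g0 + of_nat s0 *s w \<in> M" by blast
  define v0 where "v0 = g0 + of_nat s0 *s w"
  define S where "S = M \<inter> gaussian_vec"
  show False
  proof (cases "v0 \<in> vec.span S")
    case True
    \<comment> \<open>A point outside \<open>M\<close> ensures that the form vanishing on
      \<open>M\<close> is nonzero.\<close>
    obtain u where "u \<notin> M" using M(3) by blast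
    then obtain c where c: "\<And>z. z \<in> M \<Longrightarrow> (\<Sum>j\<in>UNIV. c j * z $ j) = 0" "(\<Sum>j\<in>UNIV. c j * u $ j) = 1"
      using separating_form[OF M(1)] by metis
    have nz: "c \<noteq> (\<lambda>_. 0)" using c(2) by auto
    have S: "S \<subseteq> gaussian_vec" and ann: "\<And>z. z \<in> S \<Longrightarrow> (\<Sum>j\<in>UNIV. c j * z $ j) = 0"
      using c(1) by (auto simp: S_def)
    obtain a b :: "'n \<Rightarrow> rat" where "\<exists>j. a j \<noteq> 0 \<or> b j \<noteq> 0"
      "\<And>z. z \<in> vec.span S \<Longrightarrow> (\<Sum>j\<in>UNIV. Complex (of_rat (a j)) (of_rat (b j)) * z $ j) = 0"
      by (rule rational_annihilator[OF S nz ann]) (assumption, rule that)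
    then show False
      using rational_form_nonzero[OF ind _ g0 s0] True unfolding v0_def w_def by blast
  next
    case False
    then obtain c where c: "\<And>z. z \<in> vec.span S \<Longrightarrow> (\<Sum>j\<in>UNIV. c j * z $ j) = 0"
      "(\<Sum>j\<in>UNIV. c j * v0 $ j) = 1"
      using separating_form[OF vec.subspace_span] by metis
    define f where "f = (\<lambda>z :: complex ^ 'n. \<Sum>j\<in>UNIV. c j * z $ j)"
    have f_comb: "f (x *s y - t *s z) = x * f y - t * f z" for x y t z
      by (simp add: f_def ring_distribs sum_subtractf sum_distrib_left mult.left_commute)
    have nonneg: "Re (f v) \<ge> 0" if v: "v \<in> A_set \<alpha> \<beta> \<inter> M" for v
    proof -
      obtain g and s :: nat where g: "g \<in> gaussian_vec" "v = g + of_nat s *s w"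
        using A_set_cases[of v \<alpha> \<beta>] v unfolding w_def by blast
      \<comment> \<open>The multiples of \<open>w\<close> cancel, leaving a Gaussian integer
        vector.\<close>
      have "of_nat s0 *s v - of_nat s *s v0 = of_nat s0 *s g - of_nat s *s g0"
        by (simp add: g(2) v0_def vec_eq_iff algebra_simps)
      moreover have "of_nat s0 *s v - of_nat s *s v0 \<in> M"
        using v v0M M(1) by (intro vec.subspace_diff vec.subspace_scale) (auto simp: v0_def)
      ultimately have "of_nat s0 *s v - of_nat s *s v0 \<in> S"
        using gaussian_vec_combination[OF g(1) g0] by (simp add: S_def)
      then have "f (of_nat s0 *s v - of_nat s *s v0) = 0"
        using c(1) vec.span_base unfolding f_def by blast
      then have "of_nat s0 * f v = of_nat s"
        using c(2) by (simp add: f_comb) (simp add: f_def)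
      then have "f v = of_real (real s / real s0)"
        using s0 by (simp add: field_simps)
      then show ?thesis by simp
    qed
    \<comment> \<open>The value of \<open>f\<close> at \<open>- v0\<close> is -1, at distance at
      least 1 from every nonnegative real.\<close>
    have "- v0 \<in> M" using v0M M(1) vec.subspace_neg unfolding v0_def by blast
    moreover have "continuous_on UNIV (\<lambda>z. Re (f z))"
      unfolding f_def by (intro continuous_intros)
    ultimately obtain y where "y \<in> A_set \<alpha> \<beta> \<inter> M" "dist (Re (f y)) (Re (f (- v0))) < 1"
      using closure_approx_image[OF dense, of "- v0" 1 "\<lambda>z. Re (f z)"] by auto
    moreover have "f (- v0) = - 1"
      using c(2) by (simp add: f_def sum_negf)
    ultimately show False
      using nonneg[of y] by (simp add: dist_real_def)
  qed
qed

theorem theorem2p4: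
  fixes \<alpha> \<beta> :: "real ^ 'n"
  assumes "CARD('n) \<ge> 2"
    and "\<And>j. \<alpha> $ j < 0" and "\<And>j. \<beta> $ j < 0"
    and "rat_independent_family
           (case_option 1 (case_sum (\<lambda>j. \<alpha> $ j) (\<lambda>j. \<beta> $ j)) :: ('n + 'n) option \<Rightarrow> real)"
  shows "closure (A_set \<alpha> \<beta>) = UNIV \<and>
    (\<forall>M :: (complex ^ 'n) set. vec.subspace M \<and> M \<noteq> {0} \<and> M \<noteq> UNIV \<longrightarrow>
       top_of_set M closure_of (A_set \<alpha> \<beta> \<inter> M) \<noteq> M)"
proof (intro conjI allI impI)
  show "closure (A_set \<alpha> \<beta>) = UNIV"
    using assms(2-4) by (rule closure_A_set)
  fix M :: "(complex ^ 'n) set"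
  assume M: "vec.subspace M \<and> M \<noteq> {0} \<and> M \<noteq> UNIV"
  \<comment> \<open>If the closure relative to \<open>M\<close> were all of \<open>M\<close>, then
    \<open>M\<close> would lie in the ambient closure.\<close>
  have "top_of_set M closure_of (A_set \<alpha> \<beta> \<inter> M) \<subseteq> closure (A_set \<alpha> \<beta> \<inter> M)"
    by (simp add: closure_of_subtopology Int_absorb1)
  then show "top_of_set M closure_of (A_set \<alpha> \<beta> \<inter> M) \<noteq> M"
    using A_set_not_dense_in_subspace[OF assms(4)] M by metis
qed

end
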